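(* Let $N\in\mathbb{N}$ and $m^\star\in\{2,\ldots,N-1\}$, and let a multistep feedback law $\mu_{N,m^\star}:X\times\{0,\ldots,m^\star-1\}\to U$ and a function $V_N:X\to[0,\infty)$ be given. Assume that for each $x\in\mathbb{X}$ the control sequence $(\mu_{N,m^\star}(x,0),\ldots,\mu_{N,m^\star}(x,m^\star-1))$ is admissible for $x$, i.e. belongs to $\mathcal{U}^{m^\star}(x)$. Suppose that for some $\alpha\in(0,1]$, with $\mu=\mu_{N,m^\star}$, $$V_N(x)-V_N(x_\mu(m;x))\ \ge\ \alpha\sum_{n=0}^{m-1}\ell(x_\mu(n;x),\mu(x,n))$$ holds for each $m\in\{1,2,\ldots,m^\star\}$ and each $x\in X$. Then $$\alpha V_\infty(x)\le\alpha J_\infty^{\mu_{N,M}}(x)\le V_N(x)$$ holds for all $x\in\mathbb{X}$ and all sequences of control horizons $M=(m_k)_{k\in\mathbb{N}_0}$ with $m_k\in\mathbb{N}$, $1\le m_k\le m^\star$ for all $k\in\mathbb{N}_0$. If, in addition, there exist $\mathcal{K}_\infty$-functions $\underline\eta,\bar\eta$ such that $\underline\eta(d_X(x,x^\star))\le V_1(x)$ and $V_N(x)\le\bar\eta(d_X(x,x^\star))$ for all $x\in\mathbb{X}$, where $V_1(x):=\min_{u\in\mathbb{U}:\,f(x,u)\in\mathbb{X}}\ell(x,u)$, then for each such $M$ the closed loop with feedback $\mu_{N,M}$ is asymptotically stable at $x^\star$.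
   Context: Setting. $(X,d_X)$ and $(U,d_U)$ are metric spaces, $f:X\times U\to X$, and the control system is $x(n+1)=f(x(n),u(n))$. $\mathbb{X}\subseteq X$ and $\mathbb{U}\subseteq U$ are constraint sets. For $x\in\mathbb{X}$ and a control sequence $u$, $x_u(\cdot;x)$ denotes the trajectory with $x_u(0;x)=x$, $x_u(n+1;x)=f(x_u(n;x),u(n))$. $\mathcal{U}^K(x)$ is the set of admissible control sequences $(u(0),\ldots,u(K-1))$, i.e. those with $u(n)\in\mathbb{U}$ and $f(x_u(n;x),u(n))\in\mathbb{X}$ for $n=0,\ldots,K-1$; $\mathcal{U}^\infty(x)$ is defined analogously for infinite sequences. $V_\infty(x)=\inf_{u\in\mathcal{U}^\infty(x)}\sum_{n=0}^\infty\ell(x_u(n;x),u(n))$. $x^\star\in\mathbb{X}$ is a controlled equilibrium: $f(x^\star,u^\star)=x^\star$ for some control value $u^\star$. The stage cost $\ell:X\times U\to[0,\infty)$ is continuous with $\ell(x^\star,u^\star)=0$ and $\ell(x,u)>0$ for all $u\in U$ and all $x\ne x^\star$. Standing assumption: for each $x\in\mathbb{X}$ the minimum defining $V_1(x)$ exists. For $\mu=\mu_{N,m^\star}$ and $n\in\{0,\ldots,m^\star\}$, $x_\mu(n;x)$ is the state reached from $x$ by applying the controls $\mu(x,0),\ldots,\mu(x,n-1)$ in open loop: $x_\mu(0;x)=x$, $x_\mu(n+1;x)=f(x_\mu(n;x),\mu(x,n))$ for $n<m^\star$. Time varying control horizon. Given $M=(m_k)_{k\in\mathbb{N}_0}$ with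 $1\le m_k\le m^\star$, let $\sigma(k):=\sum_{i=0}^{k-1}m_i$ be the update times and $\varphi(n):=\max\{\sigma(k): k\in\mathbb{N}_0,\ \sigma(k)\le n\}$ the last update time up to $n$. The closed loop with feedback $\mu_{N,M}$ is $x_{\mu_{N,M}}(0;x)=x$, $$x_{\mu_{N,M}}(n+1;x)=f\big(x_{\mu_{N,M}}(n;x),\ \mu_{N,m^\star}(x_{\mu_{N,M}}(\varphi(n);x),\,n-\varphi(n))\big),$$ i.e. after the $k$th update the first $m_k$ elements of the feedback's control sequence are applied in open loop. Its cost is $J_\infty^{\mu_{N,M}}(x)=\sum_{n=0}^\infty\ell\big(x_{\mu_{N,M}}(n;x),\mu_{N,m^\star}(x_{\mu_{N,M}}(\varphi(n);x),n-\varphi(n))\big)$. Asymptotic stability of the closed loop at $x^\star$ means: for every $\varepsilon>0$ there is $\delta>0$ such that $d_X(x_{\mu_{N,M}}(n;x),x^\star)<\varepsilon$ for all $n\in\mathbb{N}_0$ and all $x\in\mathbb{X}$ with $d_X(x,x^\star)<\delta$; and $x_{\mu_{N,M}}(n;x)\to x^\star$ as $n\to\infty$ for every $x\in\mathbb{X}$. A $\mathcal{K}_\infty$-function is a continuous, strictly increasing, unbounded $\rho:[0,\infty)\to[0,\infty)$ with $\rho(0)=0$. *)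

theory Defs
  imports "HOL-Analysis.Analysis"
begin

(* The metric spaces X and U are the types 'x and 'u; the constraint sets are
   XX :: 'x set and UU :: 'u set. A control sequence of length K is represented
   by a total function on nat of which only the values below K are used. *)

primrec trajectory :: "('x \<Rightarrow> 'u \<Rightarrow> 'x) \<Rightarrow> (nat \<Rightarrow> 'u) \<Rightarrow> 'x \<Rightarrow> nat \<Rightarrow> 'x" where
  "trajectory f u x 0 = x"
| "trajectory f u x (Suc n) = f (trajectory f u x n) (u n)"

definition admissible ::
    "('x \<Rightarrow> 'u \<Rightarrow> 'x) \<Rightarrow> 'x set \<Rightarrow> 'u set \<Rightarrow> nat \<Rightarrow> 'x \<Rightarrow> (nat \<Rightarrow> 'u) set" where
  "admissible f XX UU K x =
     {u. \<forall>n<K. u n \<in> UU \<and> f (trajectory f u x n) (u n) \<in> XX}"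

definition admissible_inf ::
    "('x \<Rightarrow> 'u \<Rightarrow> 'x) \<Rightarrow> 'x set \<Rightarrow> 'u set \<Rightarrow> 'x \<Rightarrow> (nat \<Rightarrow> 'u) set" where
  "admissible_inf f XX UU x =
     {u. \<forall>n. u n \<in> UU \<and> f (trajectory f u x n) (u n) \<in> XX}"

(* Infinite-horizon costs may diverge, hence values in [0,\<infinity>]. *)

definition V_inf ::
    "('x \<Rightarrow> 'u \<Rightarrow> 'x) \<Rightarrow> 'x set \<Rightarrow> 'u set \<Rightarrow> ('x \<Rightarrow> 'u \<Rightarrow> real) \<Rightarrow> 'x \<Rightarrow> ennreal" where
  "V_inf f XX UU l x =
     (INF u\<in>admissible_inf f XX UU x. \<Sum>n. ennreal (l (trajectory f u x n) (u n)))"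

(* Meaningful only where the minimum is attained, i.e. where V1_exists holds. *)

definition V1 ::
    "('x \<Rightarrow> 'u \<Rightarrow> 'x) \<Rightarrow> 'x set \<Rightarrow> 'u set \<Rightarrow> ('x \<Rightarrow> 'u \<Rightarrow> real) \<Rightarrow> 'x \<Rightarrow> real" where
  "V1 f XX UU l x = l x (ARG_MIN (l x) u. u \<in> UU \<and> f x u \<in> XX)"

definition V1_exists ::
    "('x \<Rightarrow> 'u \<Rightarrow> 'x) \<Rightarrow> 'x set \<Rightarrow> 'u set \<Rightarrow> ('x \<Rightarrow> 'u \<Rightarrow> real) \<Rightarrow> 'x \<Rightarrow> bool" where
  "V1_exists f XX UU l x \<longleftrightarrow> (\<exists>u. is_arg_min (l x) (\<lambda>u. u \<in> UU \<and> f x u \<in> XX) u)"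

definition update_time :: "(nat \<Rightarrow> nat) \<Rightarrow> nat \<Rightarrow> nat" where
  "update_time M k = (\<Sum>i<k. M i)"

definition last_update :: "(nat \<Rightarrow> nat) \<Rightarrow> nat \<Rightarrow> nat" where
  "last_update M n = Max {update_time M k | k. update_time M k \<le> n}"

lemma last_update_le: "last_update M n \<le> n"
proof -
  let ?S = "{update_time M k | k. update_time M k \<le> n}"
  have "finite ?S" by (rule finite_subset[of _ "{..n}"]) auto
  moreover have "update_time M 0 \<in> ?S"
    by (auto simp: update_time_def intro!: exI[of _ 0])
  ultimately have "Max ?S \<in> ?S" by (intro Max_in) auto
  then show ?thesis unfolding last_update_def by auto
qed

function closed_loop ::
    "('x \<Rightarrow> 'u \<Rightarrow> 'x) \<Rightarrow> ('x \<Rightarrow> nat \<Rightarrow> 'u) \<Rightarrow> (nat \<Rightarrow> nat) \<Rightarrow> 'x \<Rightarrow> nat \<Rightarrow> 'x" where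
  "closed_loop f \<mu> M x 0 = x"
| "closed_loop f \<mu> M x (Suc n) =
     f (closed_loop f \<mu> M x n)
       (\<mu> (closed_loop f \<mu> M x (last_update M n)) (n - last_update M n))"
  by pat_completeness auto
termination
  by (relation "Wellfounded.measure (\<lambda>(f, \<mu>, M, x, n). n)") (auto simp: less_Suc_eq_le last_update_le)

definition J_inf ::
    "('x \<Rightarrow> 'u \<Rightarrow> 'x) \<Rightarrow> ('x \<Rightarrow> 'u \<Rightarrow> real) \<Rightarrow> ('x \<Rightarrow> nat \<Rightarrow> 'u) \<Rightarrow> (nat \<Rightarrow> nat) \<Rightarrow> 'x \<Rightarrow> ennreal" where
  "J_inf f l \<mu> M x =
     (\<Sum>n. ennreal (l (closed_loop f \<mu> M x n)
        (\<mu> (closed_loop f \<mu> M x (last_update M n)) (n - last_update M n))))"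

definition asymptotically_stable ::
    "('x::metric_space \<Rightarrow> 'u \<Rightarrow> 'x) \<Rightarrow> 'x set \<Rightarrow> ('x \<Rightarrow> nat \<Rightarrow> 'u) \<Rightarrow> (nat \<Rightarrow> nat) \<Rightarrow> 'x \<Rightarrow> bool" where
  "asymptotically_stable f XX \<mu> M xs \<longleftrightarrow>
     (\<forall>\<epsilon>>0. \<exists>\<delta>>0. \<forall>n. \<forall>x\<in>XX. dist x xs < \<delta> \<longrightarrow> dist (closed_loop f \<mu> M x n) xs < \<epsilon>) \<and>
     (\<forall>x\<in>XX. closed_loop f \<mu> M x \<longlonglongrightarrow> xs)"

definition K_infinity :: "(real \<Rightarrow> real) \<Rightarrow> bool" where
  "K_infinity \<rho> \<longleftrightarrow>
     \<rho> \<in> {0..} \<rightarrow> {0..} \<and> continuous_on {0..} \<rho> \<and> strict_mono_on {0..} \<rho> \<and>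
     \<not> bdd_above (\<rho> ` {0..}) \<and> \<rho> 0 = 0"

end

theory Submission
  imports Defs
begin

text \<open>
  Summing the relaxed dynamic programming inequality over the consecutive update intervals
  telescopes, so \<open>\<alpha>\<close> times the closed-loop cost is at most \<open>V_N x\<close>.  Since the closed loop is an
  admissible trajectory, every single stage cost along it dominates \<open>V1\<close> and hence
  \<open>\<eta>1 (dist _ xs)\<close>.  A single stage cost is at most \<open>V_N x / \<alpha> \<le> \<eta>2 (dist x xs) / \<alpha>\<close>, which is
  stability, also between update times; the stage costs are summable, hence tend to 0, which is
  attraction.
\<close>

section \<open>Update times and the partition of the time axis\<close>

lemma update_time_0 [simp]: "update_time M 0 = 0"
  and update_time_Suc [simp]: "update_time M (Suc k) = update_time M k + M k"
  by (simp_all add: update_time_def)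

lemma update_time_mono: "j \<le> k \<Longrightarrow> update_time M j \<le> update_time M k"
  unfolding update_time_def by (rule sum_mono2) auto

lemma update_time_ge:
  assumes "\<And>k. 1 \<le> M k"
  shows "k \<le> update_time M k"
proof (induction k)
  case (Suc k)
  then show ?case using assms[of k] by simp
qed simp

text \<open>The update after \<open>update_time M k\<close> happens at
  \<open>update_time M k + M k\<close>, strictly beyond \<open>update_time M k + j\<close>.
  Monotonicity of \<open>update_time\<close> excludes all later ones.\<close>

lemma last_update_eq:
  assumes "j < M k"
  shows "last_update M (update_time M k + j) = update_time M k"
  unfolding last_update_def
proof (rule Max_eqI)
  show "finite {update_time M i |i. update_time M i \<le> update_time M k + j}"
    by (rule finite_subset[of _ "{..update_time M k + j}"]) auto
  show "update_time M k \<in> {update_time M i |i. update_time M i \<le> update_time M k + j}"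
    by auto
next
  fix t assume "t \<in> {update_time M i |i. update_time M i \<le> update_time M k + j}"
  then obtain i where i: "t = update_time M i" "update_time M i \<le> update_time M k + j"
    by auto
  have "i \<le> k"
  proof (rule ccontr)
    assume "\<not> i \<le> k"
    then have "update_time M (Suc k) \<le> update_time M i" by (intro update_time_mono) simp
    with i assms show False by simp
  qed
  then show "t \<le> update_time M k" using i update_time_mono by simp
qed

text \<open>Nonempty control horizons make the update intervals cover all of \<open>nat\<close>.
  Statements about arbitrary times thus reduce to position \<open>j\<close> in interval
  \<open>k\<close>.\<close>

lemma update_time_decomp:
  assumes "\<And>k. 1 \<le> M k"
  obtains k j where "n = update_time M k + j" "j < M k"
proof -
  have "\<exists>k j. n = update_time M k + j \<and> j < M k"
  proof (induction n)
    case 0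
    then show ?case using assms[of 0] by (intro exI[of _ 0]) auto
  next
    case (Suc n)
    then obtain k j where kj: "n = update_time M k + j" "j < M k" by blast
    show ?case
    proof (cases "Suc j < M k")
      case True
      then show ?thesis using kj by (intro exI[of _ k] exI[of _ "Suc j"]) simp
    next
      case False
      \<comment> \<open>Here \<open>Suc j = M k\<close>, so \<open>Suc n\<close> is exactly the next
        update time and starts a new interval at offset 0.\<close>
      then have "Suc n = update_time M (Suc k) + 0" using kj by simp
      then show ?thesis using assms[of "Suc k"] by (intro exI[of _ "Suc k"] exI[of _ 0]) auto
    qed
  qed
  then show ?thesis using that by blast
qed

section \<open>The closed loop as an admissible open-loop trajectory\<close>

definition closed_loop_control ::
    "('x \<Rightarrow> 'u \<Rightarrow> 'x) \<Rightarrow> ('x \<Rightarrow> nat \<Rightarrow> 'u) \<Rightarrow> (nat \<Rightarrow> nat) \<Rightarrow> 'x \<Rightarrow> nat \<Rightarrow> 'u" where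
  "closed_loop_control f \<mu> M x n =
     \<mu> (closed_loop f \<mu> M x (last_update M n)) (n - last_update M n)"

text \<open>For a fixed initial state the feedback amounts to a single open-loop sequence. In this
  form the closed loop can compete in the infimum defining \<open>V_inf\<close>.\<close>

lemma closed_loop_eq_trajectory:
  "closed_loop f \<mu> M x n = trajectory f (closed_loop_control f \<mu> M x) x n"
  by (induction n) (simp_all add: closed_loop_control_def)

lemma closed_loop_control_update:
  assumes "j < M k"
  shows "closed_loop_control f \<mu> M x (update_time M k + j) =
    \<mu> (closed_loop f \<mu> M x (update_time M k)) j"
  using assms by (simp add: closed_loop_control_def last_update_eq)

text \<open>No update occurs strictly inside interval \<open>k\<close>, so all its controls come
  from \<open>\<mu> y\<close>. The endpoint \<open>j = M k\<close> is included: reaching it uses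
  only controls with index below \<open>M k\<close>, and it is the state at the next update.\<close>

lemma closed_loop_update:
  fixes f :: "'x \<Rightarrow> 'u \<Rightarrow> 'x" and \<mu> :: "'x \<Rightarrow> nat \<Rightarrow> 'u" and x :: 'x
  assumes "j \<le> M k"
  defines "y \<equiv> closed_loop f \<mu> M x (update_time M k)"
  shows "closed_loop f \<mu> M x (update_time M k + j) = trajectory f (\<mu> y) y j"
  using assms(1)
proof (induction j)
  case 0
  then show ?case by (simp add: y_def)
next
  case (Suc j)
  then have "closed_loop f \<mu> M x (update_time M k + Suc j) =
      f (trajectory f (\<mu> y) y j) (closed_loop_control f \<mu> M x (update_time M k + j))"
    by (simp add: closed_loop_control_def)
  also have "\<dots> = trajectory f (\<mu> y) y (Suc j)"
    using Suc.prems by (simp add: closed_loop_control_update y_def)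
  finally show ?case .
qed

text \<open>Admissibility constrains successor states; the case \<open>n = 0\<close> rests on
  \<open>x \<in> XX\<close>.\<close>

lemma trajectory_mem:
  assumes "x \<in> XX" "u \<in> admissible f XX UU K x" "n \<le> K"
  shows "trajectory f u x n \<in> XX"
  using assms by (cases n) (auto simp: admissible_def)

text \<open>Admissibility of the feedback sequence is given at states in \<open>XX\<close>, so
  membership is carried from one update state to the next.\<close>

lemma closed_loop_update_mem:
  assumes adm: "\<And>x. x \<in> XX \<Longrightarrow> \<mu> x \<in> admissible f XX UU K x"
    and M: "\<And>k. M k \<le> K" and x: "x \<in> XX"
  shows "closed_loop f \<mu> M x (update_time M k) \<in> XX"
proof (induction k)
  case (Suc k)
  then show ?case
    using closed_loop_update[of "M k" M k f \<mu> x] trajectory_mem[OF Suc adm[OF Suc] M[of k]]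
    by simp
qed (simp add: x)

lemma closed_loop_control_admissible:
  assumes adm: "\<And>x. x \<in> XX \<Longrightarrow> \<mu> x \<in> admissible f XX UU K x"
    and M: "\<And>k. 1 \<le> M k" "\<And>k. M k \<le> K" and x: "x \<in> XX"
  shows "closed_loop_control f \<mu> M x \<in> admissible_inf f XX UU x"
proof -
  have "closed_loop_control f \<mu> M x n \<in> UU \<and>
      f (closed_loop f \<mu> M x n) (closed_loop_control f \<mu> M x n) \<in> XX" for n
  proof -
    obtain k j where n: "n = update_time M k + j" and j: "j < M k"
      by (rule update_time_decomp[OF M(1)])
    let ?y = "closed_loop f \<mu> M x (update_time M k)"
    have "\<mu> ?y \<in> admissible f XX UU K ?y"
      by (intro adm closed_loop_update_mem[OF adm M(2) x])
    then show ?thesis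
      using j M(2)[of k]
      by (simp add: n closed_loop_control_update closed_loop_update admissible_def)
  qed
  then show ?thesis by (simp add: admissible_inf_def closed_loop_eq_trajectory)
qed

section \<open>Cost of the closed loop\<close>

lemma sum_lessThan_add:
  fixes g :: "nat \<Rightarrow> 'a::comm_monoid_add"
  shows "(\<Sum>i<a + b. g i) = (\<Sum>i<a. g i) + (\<Sum>i<b. g (a + i))"
  by (induction b) (simp_all add: add.assoc)

lemma closed_loop_cost_telescope:
  fixes l :: "'x \<Rightarrow> 'u \<Rightarrow> real"
  assumes descent: "\<And>m x. m \<in> {1..K} \<Longrightarrow>
      V x - V (trajectory f (\<mu> x) x m) \<ge> \<alpha> * (\<Sum>n<m. l (trajectory f (\<mu> x) x n) (\<mu> x n))"
    and M: "\<And>k. 1 \<le> M k" "\<And>k. M k \<le> K"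
  shows "\<alpha> * (\<Sum>n<update_time M k. l (closed_loop f \<mu> M x n) (closed_loop_control f \<mu> M x n))
    \<le> V x - V (closed_loop f \<mu> M x (update_time M k))"
proof (induction k)
  case (Suc k)
  let ?c = "\<lambda>n. l (closed_loop f \<mu> M x n) (closed_loop_control f \<mu> M x n)"
  let ?y = "closed_loop f \<mu> M x (update_time M k)"
  have "(\<Sum>n<M k. ?c (update_time M k + n)) =
      (\<Sum>n<M k. l (trajectory f (\<mu> ?y) ?y n) (\<mu> ?y n))"
    by (rule sum.cong) (simp_all add: closed_loop_update closed_loop_control_update)
  \<comment> \<open>The descent inequality is used at the update state \<open>?y\<close> with
    \<open>m = M k\<close>; its right-hand side is the cost of interval \<open>k\<close>. Added to
    the induction hypothesis, the two occurrences of \<open>V ?y\<close> cancel.\<close>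
  moreover have "V ?y - V (closed_loop f \<mu> M x (update_time M (Suc k))) \<ge>
      \<alpha> * (\<Sum>n<M k. l (trajectory f (\<mu> ?y) ?y n) (\<mu> ?y n))"
    using descent[of "M k" ?y] M[of k] by (simp add: closed_loop_update)
  ultimately show ?case
    using Suc by (simp add: sum_lessThan_add distrib_left)
qed simp

lemma closed_loop_cost_bound:
  fixes l :: "'x \<Rightarrow> 'u \<Rightarrow> real"
  assumes descent: "\<And>m x. m \<in> {1..K} \<Longrightarrow>
      V x - V (trajectory f (\<mu> x) x m) \<ge> \<alpha> * (\<Sum>n<m. l (trajectory f (\<mu> x) x n) (\<mu> x n))"
    and M: "\<And>k. 1 \<le> M k" "\<And>k. M k \<le> K"
    and l: "\<And>x u. 0 \<le> l x u" and V: "\<And>x. 0 \<le> V x" and \<alpha>: "0 \<le> \<alpha>"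
  shows "\<alpha> * (\<Sum>i<n. l (closed_loop f \<mu> M x i) (closed_loop_control f \<mu> M x i)) \<le> V x"
proof -
  let ?c = "\<lambda>i. l (closed_loop f \<mu> M x i) (closed_loop_control f \<mu> M x i)"
  \<comment> \<open>Every interval has length at least 1, so \<open>n \<le> update_time M n\<close>.
    Nonnegative stage costs then allow the sum to be extended to an update time, where the
    telescoped estimate holds.\<close>
  have "(\<Sum>i<n. ?c i) \<le> (\<Sum>i<update_time M n. ?c i)"
    using update_time_ge[of M n, OF M(1)] by (intro sum_mono2) (auto simp: l)
  then have "\<alpha> * (\<Sum>i<n. ?c i) \<le> \<alpha> * (\<Sum>i<update_time M n. ?c i)"
    by (rule mult_left_mono[OF _ \<alpha>])
  also have "\<dots> \<le> V x - V (closed_loop f \<mu> M x (update_time M n))"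
    by (rule closed_loop_cost_telescope[OF descent M])
  also have "\<dots> \<le> V x" using V by simp
  finally show ?thesis .
qed

lemma V_inf_le_J_inf:
  assumes "closed_loop_control f \<mu> M x \<in> admissible_inf f XX UU x"
  shows "V_inf f XX UU l x \<le> J_inf f l \<mu> M x"
proof -
  have "J_inf f l \<mu> M x = (\<Sum>n. ennreal (l (trajectory f (closed_loop_control f \<mu> M x) x n)
      (closed_loop_control f \<mu> M x n)))"
    by (simp add: J_inf_def closed_loop_control_def flip: closed_loop_eq_trajectory)
  then show ?thesis
    unfolding V_inf_def by (simp only:) (rule INF_lower[OF assms])
qed

text \<open>Passes from a uniform bound on real partial sums to the series in
  \<open>ennreal\<close>, which always has a value.\<close>

lemma ennreal_cmult_suminf_le:
  fixes c :: "nat \<Rightarrow> real"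
  assumes a: "0 \<le> a" and c: "\<And>n. 0 \<le> c n" and bound: "\<And>n. a * (\<Sum>i<n. c i) \<le> b"
  shows "ennreal a * (\<Sum>n. ennreal (c n)) \<le> ennreal b"
proof -
  have "(\<Sum>n. ennreal (a * c n)) \<le> ennreal b"
  proof (rule suminf_le_const)
    fix n
    have "(\<Sum>i<n. ennreal (a * c i)) = ennreal (a * (\<Sum>i<n. c i))"
      using a c by (simp add: sum_ennreal sum_distrib_left)
    then show "(\<Sum>i<n. ennreal (a * c i)) \<le> ennreal b"
      using bound[of n] by (simp add: ennreal_leI)
  qed simp
  then show ?thesis using a c by (simp add: ennreal_mult)
qed

text \<open>\<open>ARG_MIN\<close> is a Hilbert choice; \<open>V1_exists\<close> guarantees that the
  chosen control is an actual minimizer.\<close>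

lemma V1_le:
  fixes l :: "'x \<Rightarrow> 'u \<Rightarrow> real"
  assumes "V1_exists f XX UU l x" "u \<in> UU" "f x u \<in> XX"
  shows "V1 f XX UU l x \<le> l x u"
proof -
  have "is_arg_min (l x) (\<lambda>u. u \<in> UU \<and> f x u \<in> XX) (ARG_MIN (l x) u. u \<in> UU \<and> f x u \<in> XX)"
    using assms(1) unfolding V1_exists_def arg_min_def by (rule someI_ex)
  then show ?thesis using assms(2,3) by (auto simp: V1_def is_arg_min_linorder)
qed

section \<open>Comparison functions and asymptotic stability\<close>

lemma K_infinity_pos: "K_infinity \<rho> \<Longrightarrow> 0 < r \<Longrightarrow> 0 < \<rho> r"
  unfolding K_infinity_def strict_mono_on_def by (metis atLeast_iff order_less_imp_le order_refl)

lemma K_infinity_less_cancel: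
  assumes "K_infinity \<rho>" "0 \<le> r" "0 \<le> s" "\<rho> r < \<rho> s"
  shows "r < s"
  using assms strict_mono_on_less[of "{0..}" \<rho> r s] by (auto simp: K_infinity_def)

text \<open>This is continuity at 0 combined with \<open>\<rho> 0 = 0\<close>; it supplies the
  \<delta> of the stability estimate.\<close>

lemma K_infinity_small:
  assumes "K_infinity \<rho>" "0 < e"
  obtains d where "0 < d" "\<And>r. 0 \<le> r \<Longrightarrow> r < d \<Longrightarrow> \<rho> r < e"
proof -
  from assms have "continuous_on {0..} \<rho>" and zero: "\<rho> 0 = 0"
    by (auto simp: K_infinity_def)
  then obtain d where "0 < d" and d: "\<And>r. r \<in> {0..} \<Longrightarrow> dist r 0 < d \<Longrightarrow> dist (\<rho> r) (\<rho> 0) < e"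
    unfolding continuous_on_iff using \<open>0 < e\<close> by (metis atLeast_iff order_refl)
  then show ?thesis
    by (intro that[of d]) (auto simp: dist_real_def zero abs_less_iff)
qed

text \<open>For \<open>a > 0\<close> the value \<open>\<rho> a\<close> is positive, so eventually
  \<open>\<rho> (r n) < \<rho> a\<close>. Strict monotonicity turns this into
  \<open>r n < a\<close>, which takes the place of applying an inverse of \<rho>.\<close>

lemma K_infinity_tendsto_0:
  assumes \<rho>: "K_infinity \<rho>" and r: "\<And>n. 0 \<le> r n" and lim: "(\<lambda>n::nat. \<rho> (r n)) \<longlonglongrightarrow> 0"
  shows "r \<longlonglongrightarrow> 0"
proof (rule order_tendstoI)
  fix a :: real assume "a < 0"
  then show "\<forall>\<^sub>F n in sequentially. a < r n"
    using r by (auto intro: always_eventually less_le_trans)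
next
  fix a :: real assume "0 < a"
  then have "\<forall>\<^sub>F n in sequentially. \<rho> (r n) < \<rho> a"
    by (intro order_tendstoD(2)[OF lim] K_infinity_pos[OF \<rho>])
  then show "\<forall>\<^sub>F n in sequentially. r n < a"
    by eventually_elim (use K_infinity_less_cancel[OF \<rho>] r \<open>0 < a\<close> in auto)
qed

text \<open>\<open>c x n\<close> stands for the stage cost paid at time \<open>n\<close> when
  starting from \<open>x\<close>. Since \<open>lower\<close> holds at every time, the estimates also
  cover states between updates.\<close>

lemma asymptotically_stable_of_cost_bounds:
  fixes f :: "'x::metric_space \<Rightarrow> 'u \<Rightarrow> 'x" and c :: "'x \<Rightarrow> nat \<Rightarrow> real"
  assumes \<eta>: "K_infinity \<eta>1" "K_infinity \<eta>2" and \<alpha>: "0 < \<alpha>"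
    and lower: "\<And>x n. x \<in> XX \<Longrightarrow> \<eta>1 (dist (closed_loop f \<mu> M x n) xs) \<le> c x n"
    and upper: "\<And>x n. x \<in> XX \<Longrightarrow> \<alpha> * (\<Sum>i<n. c x i) \<le> \<eta>2 (dist x xs)"
  shows "asymptotically_stable f XX \<mu> M xs"
proof -
  have \<eta>1_nonneg: "0 \<le> \<eta>1 (dist y xs)" for y
    using \<eta>(1) by (auto simp: K_infinity_def)
  have c: "0 \<le> c x n" if "x \<in> XX" for x n
    using lower[OF that, of n] \<eta>1_nonneg order_trans by blast
  have stage: "\<alpha> * c x n \<le> \<eta>2 (dist x xs)" if "x \<in> XX" for x n
  proof -
    \<comment> \<open>The upper limit \<open>Suc n\<close> makes \<open>c x n\<close> the last
      summand of a nonnegative sum.\<close>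
    have "c x n \<le> (\<Sum>i<Suc n. c x i)"
      by (simp add: sum_nonneg c that)
    then have "\<alpha> * c x n \<le> \<alpha> * (\<Sum>i<Suc n. c x i)"
      using \<alpha> by simp
    with upper[OF that, of "Suc n"] show ?thesis by (rule order_trans[rotated])
  qed
  show ?thesis
    unfolding asymptotically_stable_def
  proof (intro conjI allI impI ballI)
    fix \<epsilon> :: real assume "0 < \<epsilon>"
    \<comment> \<open>This threshold for \<open>\<eta>2\<close> is chosen so that
      \<open>stage\<close>, after cancelling \<alpha>, leaves \<open>\<eta>1\<close> of the distance
      below \<open>\<eta>1 \<epsilon>\<close>.\<close>
    then have "0 < \<alpha> * \<eta>1 \<epsilon>" using \<alpha> K_infinity_pos[OF \<eta>(1)] by simp
    then obtain \<delta> where "0 < \<delta>" and \<delta>: "\<And>r. 0 \<le> r \<Longrightarrow> r < \<delta> \<Longrightarrow> \<eta>2 r < \<alpha> * \<eta>1 \<epsilon>"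
      by (rule K_infinity_small[OF \<eta>(2)]) blast
    have "dist (closed_loop f \<mu> M x n) xs < \<epsilon>" if x: "x \<in> XX" "dist x xs < \<delta>" for x n
    proof -
      have "\<alpha> * c x n < \<alpha> * \<eta>1 \<epsilon>"
        using stage[OF x(1), of n] \<delta>[of "dist x xs"] x(2) by simp
      then have "\<eta>1 (dist (closed_loop f \<mu> M x n) xs) < \<eta>1 \<epsilon>"
        using lower[OF x(1), of n] \<alpha> by simp
      then show ?thesis
        by (rule K_infinity_less_cancel[OF \<eta>(1), rotated 2]) (use \<open>0 < \<epsilon>\<close> in auto)
    qed
    with \<open>0 < \<delta>\<close>
    show "\<exists>\<delta>>0. \<forall>n. \<forall>x\<in>XX. dist x xs < \<delta> \<longrightarrow> dist (closed_loop f \<mu> M x n) xs < \<epsilon>" by blast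
  next
    fix x assume x: "x \<in> XX"
    have "summable (c x)"
    proof (rule summableI_nonneg_bounded)
      show "(\<Sum>i<n. c x i) \<le> \<eta>2 (dist x xs) / \<alpha>" for n
        using upper[OF x, of n] \<alpha> by (simp add: field_simps)
    qed (rule c[OF x])
    then have "c x \<longlonglongrightarrow> 0" by (rule summable_LIMSEQ_zero)
    \<comment> \<open>The sequence is squeezed between 0 and \<open>c x\<close>.\<close>
    then have "(\<lambda>n. \<eta>1 (dist (closed_loop f \<mu> M x n) xs)) \<longlonglongrightarrow> 0"
      by (rule tendsto_sandwich[OF _ _ tendsto_const, rotated 2])
        (simp_all add: \<eta>1_nonneg lower[OF x])
    then have "(\<lambda>n. dist (closed_loop f \<mu> M x n) xs) \<longlonglongrightarrow> 0"
      by (rule K_infinity_tendsto_0[OF \<eta>(1), rotated]) simp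
    then show "closed_loop f \<mu> M x \<longlonglongrightarrow> xs" by (subst tendsto_dist_iff)
  qed
qed

theorem theorem8:
  fixes f :: "'x::metric_space \<Rightarrow> 'u::metric_space \<Rightarrow> 'x"
    and XX :: "'x set" and UU :: "'u set"
    and l :: "'x \<Rightarrow> 'u \<Rightarrow> real"
    and xs :: 'x and us :: 'u
    and N mstar :: nat
    and \<mu> :: "'x \<Rightarrow> nat \<Rightarrow> 'u"
    and V_N :: "'x \<Rightarrow> real"
    and \<alpha> :: real
  assumes "xs \<in> XX" and "f xs us = xs"
    and "continuous_on UNIV (\<lambda>(x, u). l x u)"
    and "\<And>x u. 0 \<le> l x u"
    and "l xs us = 0"
    and "\<And>x u. x \<noteq> xs \<Longrightarrow> 0 < l x u"
    and "\<And>x. x \<in> XX \<Longrightarrow> V1_exists f XX UU l x"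
    and "mstar \<in> {2..N - 1}"
    and "\<And>x. 0 \<le> V_N x"
    and "\<And>x. x \<in> XX \<Longrightarrow> \<mu> x \<in> admissible f XX UU mstar x"
    and "\<alpha> \<in> {0<..1}"
    and "\<And>m x. m \<in> {1..mstar} \<Longrightarrow>
           V_N x - V_N (trajectory f (\<mu> x) x m)
             \<ge> \<alpha> * (\<Sum>n<m. l (trajectory f (\<mu> x) x n) (\<mu> x n))"
  shows "(\<forall>M x. (\<forall>k. 1 \<le> M k \<and> M k \<le> mstar) \<longrightarrow> x \<in> XX \<longrightarrow>
            ennreal \<alpha> * V_inf f XX UU l x \<le> ennreal \<alpha> * J_inf f l \<mu> M x \<and>
            ennreal \<alpha> * J_inf f l \<mu> M x \<le> ennreal (V_N x)) \<and>
         ((\<exists>\<eta>1 \<eta>2. K_infinity \<eta>1 \<and> K_infinity \<eta>2 \<and>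
             (\<forall>x\<in>XX. \<eta>1 (dist x xs) \<le> V1 f XX UU l x \<and> V_N x \<le> \<eta>2 (dist x xs))) \<longrightarrow>
          (\<forall>M. (\<forall>k. 1 \<le> M k \<and> M k \<le> mstar) \<longrightarrow> asymptotically_stable f XX \<mu> M xs))"
proof -
  let ?w = "closed_loop_control f \<mu>"
  let ?c = "\<lambda>M x n. l (closed_loop f \<mu> M x n) (?w M x n)"
  have \<alpha>: "0 < \<alpha>" using assms(11) by simp
  have adm: "?w M x \<in> admissible_inf f XX UU x"
    if "\<forall>k. 1 \<le> M k \<and> M k \<le> mstar" "x \<in> XX" for M x
    using that by (intro closed_loop_control_admissible[OF assms(10)]) auto
  have bound: "\<alpha> * (\<Sum>i<n. ?c M x i) \<le> V_N x"
    if "\<forall>k. 1 \<le> M k \<and> M k \<le> mstar" for M x n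
    using that \<alpha> by (intro closed_loop_cost_bound[OF assms(12) _ _ assms(4) assms(9)]) auto
  have cost: "ennreal \<alpha> * J_inf f l \<mu> M x \<le> ennreal (V_N x)"
    if "\<forall>k. 1 \<le> M k \<and> M k \<le> mstar" for M x
  proof -
    have "ennreal \<alpha> * (\<Sum>n. ennreal (?c M x n)) \<le> ennreal (V_N x)"
      using \<alpha> assms(4) bound[OF that] by (intro ennreal_cmult_suminf_le) auto
    then show ?thesis by (simp add: J_inf_def closed_loop_control_def)
  qed
  have stable: "asymptotically_stable f XX \<mu> M xs"
    if \<eta>: "K_infinity \<eta>1" "K_infinity \<eta>2"
      and V: "\<forall>x\<in>XX. \<eta>1 (dist x xs) \<le> V1 f XX UU l x \<and> V_N x \<le> \<eta>2 (dist x xs)"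
      and M: "\<forall>k. 1 \<le> M k \<and> M k \<le> mstar"
    for \<eta>1 \<eta>2 M
  proof (rule asymptotically_stable_of_cost_bounds[OF \<eta> \<alpha>])
    fix x n assume x: "x \<in> XX"
    have w: "?w M x i \<in> UU" "f (closed_loop f \<mu> M x i) (?w M x i) \<in> XX" for i
      using adm[OF M x] by (auto simp: admissible_inf_def closed_loop_eq_trajectory)
    \<comment> \<open>At time 0 this is the assumption on \<open>x\<close>; any later state is a
      successor that \<open>w(2)\<close> places in \<open>XX\<close>. It makes the lower bound
      through \<open>V1\<close> available at this state.\<close>
    have "closed_loop f \<mu> M x n \<in> XX"
      using x w(2) by (cases n) (simp_all add: closed_loop_control_def)
    then have "\<eta>1 (dist (closed_loop f \<mu> M x n) xs) \<le> V1 f XX UU l (closed_loop f \<mu> M x n)"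
      and "V1 f XX UU l (closed_loop f \<mu> M x n) \<le> ?c M x n"
      using V by (auto intro!: V1_le assms(7) w)
    then show "\<eta>1 (dist (closed_loop f \<mu> M x n) xs) \<le> ?c M x n" by simp
    show "\<alpha> * (\<Sum>i<n. ?c M x i) \<le> \<eta>2 (dist x xs)"
      by (rule order_trans[OF bound[OF M]]) (use V x in blast)
  qed
  show ?thesis
  proof (intro conjI allI impI)
    fix M :: "nat \<Rightarrow> nat" and x assume "\<forall>k. 1 \<le> M k \<and> M k \<le> mstar" "x \<in> XX"
    then show "ennreal \<alpha> * J_inf f l \<mu> M x \<le> ennreal (V_N x)"
      and "ennreal \<alpha> * V_inf f XX UU l x \<le> ennreal \<alpha> * J_inf f l \<mu> M x"
      by (simp_all add: cost mult_left_mono V_inf_le_J_inf adm)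
  qed (elim exE conjE, rule stable)
qed

end
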